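(* Let $\mathbf M\in\mathbb C^{m\times m}$ and $\mathbf N\in\mathbb C^{n\times n}$ be Hermitian positive definite, let $\mathbf A\in\mathbb C^{m\times n}$ with $\operatorname{rank}\mathbf A=r<\min\{m,n\}$, and put $\mathbf A^{\sharp}=\mathbf N^{-1}\mathbf A^{*}\mathbf M$. Then the weighted Moore–Penrose inverse $\mathbf A^{+}_{M,N}=(\tilde a^{+}_{ij})\in\mathbb C^{n\times m}$ satisfies, for all $i=1,\dots,n$, $j=1,\dots,m$, \[ \tilde a^{+}_{ij}=\frac{\sum_{\beta\in J_{r,n}\{i\}}\left|\left((\mathbf A^{\sharp}\mathbf A)_{.i}(\mathbf a^{\sharp}_{.j})\right)^{\beta}_{\beta}\right|}{\sum_{\beta\in J_{r,n}}\left|(\mathbf A^{\sharp}\mathbf A)^{\beta}_{\beta}\right|}, \] where $\mathbf a^{\sharp}_{.j}$ is the $j$-th column of $\mathbf A^{\sharp}$.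
   Context: All matrices are complex; $\mathbf M^{*}$ is the conjugate transpose. The weighted Moore–Penrose inverse $\mathbf A^{+}_{M,N}$ of $\mathbf A\in\mathbb C^{m\times n}$ is the unique $\mathbf X\in\mathbb C^{n\times m}$ with $\mathbf A\mathbf X\mathbf A=\mathbf A$, $\mathbf X\mathbf A\mathbf X=\mathbf X$, $(\mathbf M\mathbf A\mathbf X)^{*}=\mathbf M\mathbf A\mathbf X$, $(\mathbf N\mathbf X\mathbf A)^{*}=\mathbf N\mathbf X\mathbf A$. For a square matrix $\mathbf P$, $\mathbf P_{.i}(\mathbf c)$ is the matrix obtained from $\mathbf P$ by replacing its $i$-th column by the column vector $\mathbf c$. For $1\le k\le p$, $J_{k,p}$ is the set of strictly increasing sequences $(\beta_1<\dots<\beta_k)$ of elements of $\{1,\dots,p\}$ and $J_{k,p}\{i\}=\{\beta\in J_{k,p}: i\in\beta\}$. For $\beta\in J_{k,p}$, $\mathbf P^{\beta}_{\beta}$ is the principal submatrix with rows and columns indexed by $\beta$, and $|\cdot|$ denotes the determinant. *)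

theory Defs
  imports "Jordan_Normal_Form.Schur_Decomposition" "Jordan_Normal_Form.Gauss_Jordan_Elimination"
    "Jordan_Normal_Form.DL_Rank" "Jordan_Normal_Form.DL_Submatrix" "Jordan_Normal_Form.Determinant"
begin

definition hermitian_posdef :: "nat \<Rightarrow> complex mat \<Rightarrow> bool" where
  "hermitian_posdef k P \<longleftrightarrow> P \<in> carrier_mat k k \<and> mat_adjoint P = P \<and>
     (\<forall>x \<in> carrier_vec k. x \<noteq> 0\<^sub>v k \<longrightarrow>
        0 < Re (\<Sum>i<k. cnj (x $ i) * (P *\<^sub>v x) $ i))"

definition is_wmp_inverse :: "complex mat \<Rightarrow> complex mat \<Rightarrow> complex mat \<Rightarrow> complex mat \<Rightarrow> bool" where
  "is_wmp_inverse M N A X \<longleftrightarrow> X \<in> carrier_mat (dim_col A) (dim_row A) \<and>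
     A * X * A = A \<and> X * A * X = X \<and>
     mat_adjoint (M * A * X) = M * A * X \<and> mat_adjoint (N * X * A) = N * X * A"

definition wmp_inverse :: "complex mat \<Rightarrow> complex mat \<Rightarrow> complex mat \<Rightarrow> complex mat" where
  "wmp_inverse M N A = (THE X. is_wmp_inverse M N A X)"

definition sharp :: "complex mat \<Rightarrow> complex mat \<Rightarrow> complex mat \<Rightarrow> complex mat" where
  "sharp M N A = the (mat_inverse N) * mat_adjoint A * M"

end

theory Submission
  imports Defs
begin

text \<open>
  Let \<open>A = F G\<close> be a full-rank factorization and put \<open>T = A\<^sup>\<sharp> F\<close>, so that \<open>A\<^sup>\<sharp> A = T G\<close> and every
  column of \<open>A\<^sup>\<sharp>\<close> has the form \<open>T h\<close>. Comparing coefficients in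
  \<open>t ^ r * det (t I\<^sub>n + T G) = t ^ n * det (t I\<^sub>r + G T)\<close> shows that the principal minors of
  order \<open>r\<close> of \<open>T G\<close> sum up to \<open>det (G T)\<close>; positive definiteness of the weights makes this
  nonzero. Replacing column \<open>i\<close> of \<open>T G\<close> by \<open>T h\<close> amounts to replacing column \<open>i\<close> of \<open>G\<close> by \<open>h\<close>,
  and the minors avoiding \<open>i\<close> are those obtained for \<open>h = 0\<close>. The numerator is therefore a
  difference of two determinants that are rank-one perturbations of \<open>G T\<close>, which the matrix
  determinant lemma evaluates to \<open>det (G T)\<close> times the \<open>i\<close>-th entry of \<open>T (G T)\<^sup>-\<^sup>1 h\<close>, and this
  vector is the corresponding column of the weighted Moore--Penrose inverse.
\<close>

section \<open>Principal minors\<close>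

text \<open>Each element of \<open>I\<close> is hit by the index that counts the smaller elements of
  \<open>I\<close>, so the image covers \<open>I\<close>; comparing cardinalities then gives
  injectivity.\<close>

lemma bij_betw_pick:
  assumes "finite I"
  shows "bij_betw (pick I) {0..<card I} I"
proof -
  have "I \<subseteq> pick I ` {0..<card I}"
  proof
    fix i assume i: "i \<in> I"
    have "card {a \<in> I. a < i} < card I"
      by (rule psubset_card_mono[OF assms]) (use i in auto)
    then show "i \<in> pick I ` {0..<card I}"
      by (intro rev_image_eqI[of "card {a \<in> I. a < i}"]) (simp_all add: pick_card_in_set[OF i])
  qed
  moreover have "card (pick I ` {0..<card I}) \<le> card I"
    using card_image_le[of "{0..<card I}" "pick I"] by simp
  ultimately have "pick I ` {0..<card I} = I"
    by (intro card_seteq[symmetric]) simp_all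
  moreover from this have "inj_on (pick I) {0..<card I}"
    by (intro eq_card_imp_inj_on) simp_all
  ultimately show ?thesis
    by (rule bij_betw_imageI[rotated])
qed

text \<open>Conjugation by the increasing enumeration of \<open>I\<close> preserves signs, so the
  Leibniz formula may run over permutations of \<open>I\<close> itself. In this form minors of all
  sizes are compared without mentioning \<open>pick\<close>.\<close>

lemma det_principal_submatrix:
  fixes P :: "'a :: comm_ring_1 mat"
  assumes P: "P \<in> carrier_mat n n" and I: "I \<subseteq> {..<n}"
  shows "det (submatrix P I I) = (\<Sum>p | p permutes I. signof p * (\<Prod>b\<in>I. P $$ (p b, b)))"
proof -
  define k where "k = card I"
  have fin: "finite I" using I finite_subset by blast
  have bij: "bij_betw (pick I) {0..<k} I"
    unfolding k_def by (rule bij_betw_pick[OF fin])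
  have inj: "inj_on (pick I) {0..<k}"
    using bij by (rule bij_betw_imp_inj_on)
  have card: "card {i. i < n \<and> i \<in> I} = k"
    unfolding k_def using I by (intro arg_cong[where f = card]) auto
  have carr: "submatrix P I I \<in> carrier_mat k k"
    using P card by (intro carrier_matI) (auto simp: dim_submatrix)
  have entry: "submatrix P I I $$ (a, b) = P $$ (pick I a, pick I b)" if "a < k" "b < k" for a b
    using that P card by (intro submatrix_index) auto
  define g where "g = inv_into {0..<k} (pick I)"
  have bijg: "bij_betw g I {0..<k}"
    unfolding g_def by (rule bij_betw_inv_into[OF bij])
  have "det (submatrix P I I)
      = (\<Sum>q | q permutes {0..<k}. signof q * (\<Prod>j<k. submatrix P I I $$ (q j, j)))"
    by (rule det_col[OF carr])
  also have "\<dots> = (\<Sum>p | p permutes I. signof p * (\<Prod>b\<in>I. P $$ (p b, b)))"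
  proof (rule sum.reindex_bij_witness[where i = "map_permutation I g"
        and j = "map_permutation {0..<k} (pick I)"])
    fix q assume "q \<in> {q. q permutes {0..<k}}"
    then have q: "q permutes {0..<k}" by simp
    show "map_permutation I g (map_permutation {0..<k} (pick I) q) = q"
      by (rule map_permutation_compose_inv[OF bij q])
        (use bij in \<open>auto simp: g_def bij_betw_inv_into_left\<close>)
    show "map_permutation {0..<k} (pick I) q \<in> {p. p permutes I}"
      using map_permutation_permutes[OF bij q] by simp
    have "(\<Prod>b\<in>I. P $$ (map_permutation {0..<k} (pick I) q b, b))
        = (\<Prod>j\<in>{0..<k}. P $$ (map_permutation {0..<k} (pick I) q (pick I j), pick I j))"
      by (rule prod.reindex_bij_betw[OF bij, symmetric])
    also have "\<dots> = (\<Prod>j\<in>{0..<k}. submatrix P I I $$ (q j, j))"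
    proof (rule prod.cong[OF refl])
      fix j assume j: "j \<in> {0..<k}"
      then have "q j \<in> {0..<k}" using permutes_in_image[OF q] by simp
      with j show "P $$ (map_permutation {0..<k} (pick I) q (pick I j), pick I j)
          = submatrix P I I $$ (q j, j)"
        by (simp add: map_permutation_apply[OF inj j] entry)
    qed
    finally show "signof (map_permutation {0..<k} (pick I) q)
          * (\<Prod>b\<in>I. P $$ (map_permutation {0..<k} (pick I) q b, b))
        = signof q * (\<Prod>j<k. submatrix P I I $$ (q j, j))"
      using sign_map_permutation[OF inj q] by (simp add: lessThan_atLeast0)
  next
    fix p assume "p \<in> {p. p permutes I}"
    then have p: "p permutes I" by simp
    show "map_permutation {0..<k} (pick I) (map_permutation I g p) = p"
      by (rule map_permutation_compose_inv[OF bijg p])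
        (use bij in \<open>auto simp: g_def bij_betw_inv_into_right\<close>)
    show "map_permutation I g p \<in> {q. q permutes {0..<k}}"
      using map_permutation_permutes[OF bijg p] by simp
  qed
  finally show ?thesis .
qed

text \<open>Multilinear expansion: each column contributes either its entry of \<open>P\<close> or
  the diagonal term \<open>t\<close>, and \<open>I\<close> collects the columns of the first kind.
  The surviving permutations fix everything outside \<open>I\<close>, which leaves the principal
  minor on \<open>I\<close>.\<close>

lemma det_smult_one_add:
  fixes P :: "'a :: comm_ring_1 mat"
  assumes P: "P \<in> carrier_mat n n"
  shows "det (t \<cdot>\<^sub>m 1\<^sub>m n + P) = (\<Sum>I\<in>Pow {..<n}. t ^ (n - card I) * det (submatrix P I I))"
proof -
  let ?S = "{p. p permutes {0..<n}}"
  have fixed: "{p \<in> ?S. \<forall>b\<in>{..<n} - I. p b = b} = {p. p permutes I}" if "I \<subseteq> {..<n}" for I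
  proof (intro equalityI subsetI)
    fix p assume "p \<in> {p \<in> ?S. \<forall>b\<in>{..<n} - I. p b = b}"
    then show "p \<in> {p. p permutes I}"
      using permutes_superset[of p "{0..<n}" I] by (simp add: lessThan_atLeast0)
  next
    fix p assume "p \<in> {p. p permutes I}"
    then show "p \<in> {p \<in> ?S. \<forall>b\<in>{..<n} - I. p b = b}"
      using that permutes_subset[of p I "{0..<n}"] permutes_not_in[of p I]
      by (simp add: lessThan_atLeast0)
  qed
  have "det (t \<cdot>\<^sub>m 1\<^sub>m n + P)
      = (\<Sum>p\<in>?S. signof p * (\<Prod>b<n. (t \<cdot>\<^sub>m 1\<^sub>m n + P) $$ (p b, b)))"
    using P by (intro det_col) auto
  also have "\<dots> = (\<Sum>p\<in>?S. signof p * (\<Prod>b<n. P $$ (p b, b) + (if p b = b then t else 0)))"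
  proof (intro sum.cong refl arg_cong2[where f = "(*)"] prod.cong)
    fix p b assume "p \<in> ?S" "b \<in> {..<n}"
    moreover from this have "p b < n"
      using permutes_in_image[of p "{0..<n}" b] by auto
    ultimately show "(t \<cdot>\<^sub>m 1\<^sub>m n + P) $$ (p b, b) = P $$ (p b, b) + (if p b = b then t else 0)"
      using P by auto
  qed
  also have "\<dots> = (\<Sum>p\<in>?S. \<Sum>I\<in>Pow {..<n}. signof p *
      ((\<Prod>b\<in>I. P $$ (p b, b)) * (\<Prod>b\<in>{..<n} - I. if p b = b then t else 0)))"
    by (simp add: prod_add sum_distrib_left)
  also have "\<dots> = (\<Sum>I\<in>Pow {..<n}. \<Sum>p\<in>?S. signof p *
      ((\<Prod>b\<in>I. P $$ (p b, b)) * (\<Prod>b\<in>{..<n} - I. if p b = b then t else 0)))"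
    by (rule sum.swap)
  also have "\<dots> = (\<Sum>I\<in>Pow {..<n}. t ^ (n - card I) * det (submatrix P I I))"
  proof (rule sum.cong[OF refl])
    fix I assume "I \<in> Pow {..<n}"
    then have I: "I \<subseteq> {..<n}" by simp
    have fin: "finite ?S" by (simp add: finite_permutations)
    have "(\<Sum>p\<in>?S. signof p *
        ((\<Prod>b\<in>I. P $$ (p b, b)) * (\<Prod>b\<in>{..<n} - I. if p b = b then t else 0)))
      = (\<Sum>p\<in>{p \<in> ?S. \<forall>b\<in>{..<n} - I. p b = b}. signof p *
        ((\<Prod>b\<in>I. P $$ (p b, b)) * (\<Prod>b\<in>{..<n} - I. if p b = b then t else 0)))"
    \<comment> \<open>A permutation that moves some \<open>b\<close> outside \<open>I\<close> meets
      an off-diagonal zero of the scalar matrix there.\<close>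
    proof (intro sum.mono_neutral_right fin ballI)
      fix p assume "p \<in> ?S - {p \<in> ?S. \<forall>b\<in>{..<n} - I. p b = b}"
      then have "(\<Prod>b\<in>{..<n} - I. if p b = b then t else 0) = 0"
        by (intro prod_zero) auto
      then show "signof p *
        ((\<Prod>b\<in>I. P $$ (p b, b)) * (\<Prod>b\<in>{..<n} - I. if p b = b then t else 0)) = 0"
        by simp
    qed auto
    also have "\<dots> = (\<Sum>p\<in>{p \<in> ?S. \<forall>b\<in>{..<n} - I. p b = b}. t ^ (n - card I) *
        (signof p * (\<Prod>b\<in>I. P $$ (p b, b))))"
    proof (rule sum.cong[OF refl])
      fix p assume "p \<in> {p \<in> ?S. \<forall>b\<in>{..<n} - I. p b = b}"
      then have "(\<Prod>b\<in>{..<n} - I. if p b = b then t else 0) = (\<Prod>b\<in>{..<n} - I. t)"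
        by (intro prod.cong) auto
      also have "\<dots> = t ^ (n - card I)"
        using I by (simp add: card_Diff_subset finite_subset)
      finally show "signof p *
          ((\<Prod>b\<in>I. P $$ (p b, b)) * (\<Prod>b\<in>{..<n} - I. if p b = b then t else 0))
        = t ^ (n - card I) * (signof p * (\<Prod>b\<in>I. P $$ (p b, b)))"
        by (simp add: algebra_simps)
    qed
    also have "\<dots> = t ^ (n - card I) * det (submatrix P I I)"
      unfolding fixed[OF I] det_principal_submatrix[OF P I] sum_distrib_left ..
    finally show "(\<Sum>p\<in>?S. signof p *
        ((\<Prod>b\<in>I. P $$ (p b, b)) * (\<Prod>b\<in>{..<n} - I. if p b = b then t else 0)))
      = t ^ (n - card I) * det (submatrix P I I)" .
  qed
  finally show ?thesis .
qed

text \<open>The block matrix \<open>?B\<close> is made block triangular in two ways: multiplication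
  by \<open>?U\<close> clears the upper right block, by \<open>?L\<close> the lower left one.
  Comparing the two values for \<open>det ?B\<close> gives the identity without dividing by
  \<open>t\<close>.\<close>

lemma det_smult_one_add_mult_commute:
  fixes F G :: "'a :: idom mat"
  assumes F: "F \<in> carrier_mat n r" and G: "G \<in> carrier_mat r n"
  shows "t ^ r * det (t \<cdot>\<^sub>m 1\<^sub>m n + F * G) = t ^ n * det (t \<cdot>\<^sub>m 1\<^sub>m r + G * F)"
proof -
  let ?B = "four_block_mat (1\<^sub>m r) (- G) F (t \<cdot>\<^sub>m 1\<^sub>m n)"
  let ?U = "four_block_mat (1\<^sub>m r) G (0\<^sub>m n r) (1\<^sub>m n)"
  let ?L = "four_block_mat (t \<cdot>\<^sub>m 1\<^sub>m r) (0\<^sub>m r n) (- F) (1\<^sub>m n)"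
  have B: "?B \<in> carrier_mat (r + n) (r + n)" and U: "?U \<in> carrier_mat (r + n) (r + n)"
    and L: "?L \<in> carrier_mat (r + n) (r + n)"
    using F G by auto
  have "?B * ?U = four_block_mat (1\<^sub>m r) (0\<^sub>m r n) F (t \<cdot>\<^sub>m 1\<^sub>m n + F * G)"
    using F G
    by (subst mult_four_block_mat[of "1\<^sub>m r" r r "- G" n F n "t \<cdot>\<^sub>m 1\<^sub>m n" "1\<^sub>m r" r G n "0\<^sub>m n r" "1\<^sub>m n"])
      (auto intro!: cong_four_block_mat comm_add_mat)
  then have "det ?B * det ?U = det (t \<cdot>\<^sub>m 1\<^sub>m n + F * G)"
    using F G det_mult[OF B U]
    by (simp add: det_four_block_mat_upper_right_zero[where n = r and m = n])
  moreover have "det ?U = 1"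
    using G by (subst det_four_block_mat_lower_left_zero[where n = r and m = n]) auto
  ultimately have 1: "det ?B = det (t \<cdot>\<^sub>m 1\<^sub>m n + F * G)"
    by simp
  have "?B * ?L = four_block_mat (t \<cdot>\<^sub>m 1\<^sub>m r + G * F) (- G) (0\<^sub>m n r) (t \<cdot>\<^sub>m 1\<^sub>m n)"
    using F G
    by (subst mult_four_block_mat[of "1\<^sub>m r" r r "- G" n F n "t \<cdot>\<^sub>m 1\<^sub>m n" "t \<cdot>\<^sub>m 1\<^sub>m r" r "0\<^sub>m r n" n "- F" "1\<^sub>m n"])
      (auto intro!: cong_four_block_mat)
  then have "det ?B * det ?L = det (t \<cdot>\<^sub>m 1\<^sub>m r + G * F) * t ^ n"
    using F G det_mult[OF B L]
    by (simp add: det_four_block_mat_lower_left_zero[where n = r and m = n])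
  moreover have "det ?L = t ^ r"
    using F by (subst det_four_block_mat_upper_right_zero[where n = r and m = n]) auto
  ultimately show ?thesis
    using 1 by (simp add: mult.commute)
qed

lemma sum_principal_minors_mult:
  fixes F G :: "'a :: field_char_0 mat"
  assumes F: "F \<in> carrier_mat n r" and G: "G \<in> carrier_mat r n"
  shows "(\<Sum>I | I \<subseteq> {..<n} \<and> card I = r. det (submatrix (F * G) I I)) = det (G * F)"
proof -
  \<comment> \<open>The two sides of the commutation identity as formal polynomials in
    \<open>t\<close>, each determinant expanded into principal minors. In characteristic 0,
    agreement at every \<open>t\<close> makes them equal.\<close>
  define p where "p = (\<Sum>I\<in>Pow {..<n}. monom (det (submatrix (F * G) I I)) (r + (n - card I)))"
  define q where "q = (\<Sum>J\<in>Pow {..<r}. monom (det (submatrix (G * F) J J)) (n + (r - card J)))"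
  have FG: "F * G \<in> carrier_mat n n" and GF: "G * F \<in> carrier_mat r r"
    using F G by auto
  have "poly p t = poly q t" for t
    using det_smult_one_add_mult_commute[OF F G, of t]
    unfolding p_def q_def det_smult_one_add[OF FG] det_smult_one_add[OF GF]
    by (simp add: poly_sum poly_monom power_add sum_distrib_left algebra_simps)
  then have "p = q"
    using poly_eq_poly_eq_iff by blast
  then have "coeff p n = coeff q n" by simp
  moreover have "coeff p n = (\<Sum>I | I \<subseteq> {..<n} \<and> card I = r. det (submatrix (F * G) I I))"
  proof -
    \<comment> \<open>Here \<open>card I\<close> is at most \<open>n\<close>, so the truncated
      subtraction is genuine and degree \<open>n\<close> selects exactly the minors of order
      \<open>r\<close>.\<close>
    have "r + (n - card I) = n \<longleftrightarrow> card I = r" if "I \<subseteq> {..<n}" for I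
      using card_mono[OF _ that] by auto
    then show ?thesis
      unfolding p_def coeff_sum coeff_monom
      by (auto simp: sum.If_cases Int_def intro!: sum.cong arg_cong[where f = "sum _"] cong: sum.cong)
  qed
  moreover have "coeff q n = det (submatrix (G * F) {..<r} {..<r})"
  proof -
    \<comment> \<open>On this side degree \<open>n\<close> is the lowest possible one and is reached
      only by the full index set.\<close>
    have "n + (r - card J) = n \<longleftrightarrow> J = {..<r}" if "J \<subseteq> {..<r}" for J
      using card_seteq[OF _ that] by auto
    then have "coeff q n
        = (\<Sum>J\<in>Pow {..<r}. if J = {..<r} then det (submatrix (G * F) J J) else 0)"
      unfolding q_def coeff_sum coeff_monom by (intro sum.cong) auto
    then show ?thesis by simp
  qed
  moreover have "det (submatrix (G * F) {..<r} {..<r}) = det (G * F)"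
    unfolding det_principal_submatrix[OF GF subset_refl] det_col[OF GF]
    by (simp add: lessThan_atLeast0)
  ultimately show ?thesis by simp
qed

section \<open>Replacing a column of a product\<close>

lemma smult_one: "(1 :: 'a :: monoid_mult) \<cdot>\<^sub>m A = A"
  by (intro eq_matI) simp_all

lemma index_mult_mat_sum:
  assumes "A \<in> carrier_mat m k" "B \<in> carrier_mat k n" "i < m" "j < n"
  shows "(A * B) $$ (i, j) = (\<Sum>l<k. A $$ (i, l) * B $$ (l, j))"
proof -
  have "(A * B) $$ (i, j) = (\<Sum>l\<in>{0..<k}. row A i $ l * col B j $ l)"
    using assms by (simp add: scalar_prod_def)
  also have "\<dots> = (\<Sum>l\<in>{0..<k}. A $$ (i, l) * B $$ (l, j))"
    using assms by (intro sum.cong) simp_all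
  finally show ?thesis by (simp add: lessThan_atLeast0)
qed

lemma replace_col_carrier [simp]:
  "replace_col A b i \<in> carrier_mat m n \<longleftrightarrow> A \<in> carrier_mat m n"
  unfolding carrier_mat_def replace_col_def by simp

text \<open>A column of a product sees only the same column of the right factor. Hence the modified
  matrix is again a product through dimension \<open>r\<close>, and the formula for the sum of its
  minors applies.\<close>

lemma replace_col_mult:
  fixes F G :: "'a :: comm_semiring_0 mat"
  assumes F: "F \<in> carrier_mat n r" and G: "G \<in> carrier_mat r k"
    and h: "h \<in> carrier_vec r"
  shows "replace_col (F * G) (F *\<^sub>v h) i = F * replace_col G h i"
proof (rule eq_matI)
  fix a b assume "a < dim_row (F * replace_col G h i)" "b < dim_col (F * replace_col G h i)"
  then have a: "a < n" and b: "b < k" using F G by (simp_all add: replace_col_def)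
  have "col (replace_col G h i) b = (if b = i then h else col G b)"
    using b G h by (auto simp: replace_col_def)
  then show "replace_col (F * G) (F *\<^sub>v h) i $$ (a, b) = (F * replace_col G h i) $$ (a, b)"
    using a b F G by (simp add: replace_col_def)
qed (use F G in \<open>simp_all add: replace_col_def\<close>)

text \<open>Minors avoiding \<open>i\<close> do not see the replaced column, and minors containing
  \<open>i\<close> vanish when that column is zero. This trades the restriction to sets containing
  \<open>i\<close> for a difference of two unrestricted sums.\<close>

lemma sum_principal_minors_replace_col:
  fixes P :: "'a :: comm_ring_1 mat"
  assumes P: "P \<in> carrier_mat n n" and i: "i < n"
  shows "(\<Sum>I | I \<subseteq> {..<n} \<and> card I = k \<and> i \<in> I. det (submatrix (replace_col P c i) I I))
    = (\<Sum>I | I \<subseteq> {..<n} \<and> card I = k. det (submatrix (replace_col P c i) I I))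
      - (\<Sum>I | I \<subseteq> {..<n} \<and> card I = k. det (submatrix (replace_col P (0\<^sub>v n) i) I I))"
proof -
  let ?S = "{I. I \<subseteq> {..<n} \<and> card I = k}"
  have fin: "finite ?S"
    by (rule finite_subset[of _ "Pow {..<n}"]) auto
  have entry: "replace_col P d i $$ (a, b) = (if b = i then d $ a else P $$ (a, b))"
    if "a < n" "b < n" for a b d
    using that P by (simp add: replace_col_def)
  have lt: "p b < n" if "p permutes I" "b \<in> I" "I \<subseteq> {..<n}" for p b I
    using permutes_in_image[OF that(1), of b] that(2,3) by auto
  have minor_zero: "det (submatrix (replace_col P (0\<^sub>v n) i) I I) = 0"
    if I: "I \<subseteq> {..<n}" and iI: "i \<in> I" for I
  proof -
    have "(\<Prod>b\<in>I. replace_col P (0\<^sub>v n) i $$ (p b, b)) = 0" if p: "p permutes I" for p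
      using I iI i lt[OF p iI I] finite_subset[OF I]
      by (intro prod_zero bexI[of _ i]) (simp_all add: entry)
    then show ?thesis
      using P by (subst det_principal_submatrix[OF _ I]) auto
  qed
  have minor_eq: "det (submatrix (replace_col P c i) I I)
      = det (submatrix (replace_col P (0\<^sub>v n) i) I I)"
    if I: "I \<subseteq> {..<n}" and iI: "i \<notin> I" for I
  proof -
    have "(\<Prod>b\<in>I. replace_col P c i $$ (p b, b)) = (\<Prod>b\<in>I. replace_col P (0\<^sub>v n) i $$ (p b, b))"
      if p: "p permutes I" for p
    proof (rule prod.cong[OF refl])
      fix b assume b: "b \<in> I"
      then have "b \<noteq> i" "b < n" "p b < n"
        using iI I lt[OF p b I] by auto
      then show "replace_col P c i $$ (p b, b) = replace_col P (0\<^sub>v n) i $$ (p b, b)"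
        by (simp add: entry)
    qed
    then show ?thesis
      using P by (simp add: det_principal_submatrix[OF _ I])
  qed
  have "(\<Sum>I\<in>?S. det (submatrix (replace_col P c i) I I))
      - (\<Sum>I\<in>?S. det (submatrix (replace_col P (0\<^sub>v n) i) I I))
    = (\<Sum>I\<in>?S. if i \<in> I then det (submatrix (replace_col P c i) I I) else 0)"
    unfolding sum_subtractf[symmetric]
    by (intro sum.cong refl) (auto simp: minor_zero minor_eq)
  also have "\<dots> = (\<Sum>I\<in>{I\<in>?S. i \<in> I}. det (submatrix (replace_col P c i) I I))"
    by (rule sum.inter_filter[OF fin, symmetric])
  also have "{I\<in>?S. i \<in> I} = {I. I \<subseteq> {..<n} \<and> card I = k \<and> i \<in> I}"
    by auto
  finally show ?thesis by simp
qed

text \<open>Replacing column \<open>i\<close> of \<open>G\<close> adds to \<open>G * F\<close> the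
  rank-one matrix with column factor \<open>h - col G i\<close> and row factor
  \<open>row F i\<close>. Pulling out the invertible \<open>G * F\<close> leaves the determinant of
  the identity plus a rank-one matrix.\<close>

lemma det_replace_col_mult:
  fixes F G :: "'a :: idom mat"
  assumes F: "F \<in> carrier_mat n r" and G: "G \<in> carrier_mat r n" and L: "L \<in> carrier_mat r r"
    and inv: "(G * F) * L = 1\<^sub>m r" and h: "h \<in> carrier_vec r" and i: "i < n"
  shows "det (replace_col G h i * F) = det (G * F) * (1 + row F i \<bullet> (L *\<^sub>v (h - col G i)))"
proof -
  \<comment> \<open>The solution of \<open>(G * F) *\<^sub>v u = h - col G i\<close>;
    \<open>U\<close> and \<open>V\<close> are \<open>u\<close> and row \<open>i\<close> of
    \<open>F\<close> as one-column and one-row matrices.\<close>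
  define u where "u = L *\<^sub>v (h - col G i)"
  define U where "U = mat r 1 (\<lambda>(a, b). u $ a)"
  define V where "V = mat 1 r (\<lambda>(a, b). F $$ (i, b))"
  have K: "G * F \<in> carrier_mat r r" using F G by auto
  have d: "h - col G i \<in> carrier_vec r" using h G by auto
  have u: "u \<in> carrier_vec r" using L d unfolding u_def by auto
  have U: "U \<in> carrier_mat r 1" and V: "V \<in> carrier_mat 1 r"
    unfolding U_def V_def by auto
  have colU: "col U 0 = u"
    unfolding U_def using u by (intro eq_vecI) simp_all
  have Ku: "(G * F) *\<^sub>v u = h - col G i"
    unfolding u_def using assoc_mult_mat_vec[OF K L d] inv d by simp
  have KU: "((G * F) * U) $$ (a, 0) = h $ a - G $$ (a, i)" if "a < r" for a
  proof -
    have "(X * U) $$ (a, 0) = (X *\<^sub>v u) $ a" if "X \<in> carrier_mat r r" for X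
      using \<open>a < r\<close> that U colU by simp
    from this[OF K] have "((G * F) * U) $$ (a, 0) = ((G * F) *\<^sub>v u) $ a" .
    also have "\<dots> = h $ a - G $$ (a, i)"
      unfolding Ku using that G h i by auto
    finally show ?thesis .
  qed
  have "replace_col G h i * F = (G * F) * (1\<^sub>m r + U * V)"
  proof (rule eq_matI)
    fix a b assume "a < dim_row (G * F * (1\<^sub>m r + U * V))" "b < dim_col (G * F * (1\<^sub>m r + U * V))"
    then have a: "a < r" and b: "b < r" using F G U V by auto
    have "(G * F) * (1\<^sub>m r + U * V) = G * F + (G * F) * U * V"
      using mult_add_distrib_mat[OF K one_carrier_mat mult_carrier_mat[OF U V]]
        assoc_mult_mat[OF K U V] right_mult_one_mat[OF K] by simp
    then have "((G * F) * (1\<^sub>m r + U * V)) $$ (a, b)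
        = (G * F) $$ (a, b) + ((G * F) * U * V) $$ (a, b)"
      using a b F G V by simp
    also have "((G * F) * U * V) $$ (a, b) = ((G * F) * U) $$ (a, 0) * V $$ (0, b)"
      using a b K U V by (subst index_mult_mat_sum[of _ r 1 _ r]) auto
    also have "\<dots> = (h $ a - G $$ (a, i)) * F $$ (i, b)"
      using KU[OF a] b by (simp add: V_def)
    also have "(G * F) $$ (a, b) = (\<Sum>c<n. G $$ (a, c) * F $$ (c, b))"
      using a b by (intro index_mult_mat_sum[OF G F])
    finally have "((G * F) * (1\<^sub>m r + U * V)) $$ (a, b)
        = (\<Sum>c<n. G $$ (a, c) * F $$ (c, b)) + (h $ a - G $$ (a, i)) * F $$ (i, b)" .
    \<comment> \<open>The rank-one correction is absorbed into the summand \<open>c = i\<close>,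
      where it turns the entry of \<open>G\<close> into the entry of \<open>h\<close>.\<close>
    also have "\<dots> = (\<Sum>c<n. G $$ (a, c) * F $$ (c, b)
        + (if c = i then (h $ a - G $$ (a, i)) * F $$ (i, b) else 0))"
      using i by (simp add: sum.distrib)
    also have "\<dots> = (\<Sum>c<n. replace_col G h i $$ (a, c) * F $$ (c, b))"
      using a G by (intro sum.cong) (auto simp: replace_col_def algebra_simps)
    also have "\<dots> = (replace_col G h i * F) $$ (a, b)"
      using a b F G by (intro index_mult_mat_sum[symmetric]) auto
    finally show "(replace_col G h i * F) $$ (a, b) = (G * F * (1\<^sub>m r + U * V)) $$ (a, b)" ..
  qed (use F G U V in \<open>auto simp: replace_col_def\<close>)
  \<comment> \<open>The case \<open>t = 1\<close> of the commutation identity reduces the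
    determinant to size 1.\<close>
  moreover have "det (1\<^sub>m r + U * V) = det (1\<^sub>m 1 + V * U)"
    using det_smult_one_add_mult_commute[OF U V, of 1] by (simp add: smult_one)
  moreover have "det (1\<^sub>m 1 + V * U) = 1 + row F i \<bullet> u"
  proof -
    have "row V 0 = row F i"
      unfolding V_def using F i by (intro eq_vecI) simp_all
    then show ?thesis
      using U V colU by (subst det_single) simp_all
  qed
  ultimately show ?thesis
    using det_mult[OF K, of "1\<^sub>m r + U * V"] U V unfolding u_def by auto
qed

text \<open>A form of Cramer's rule: the perturbation formula is applied with \<open>h\<close> and
  with the zero vector, and in the difference both the constant 1 and the contribution of
  \<open>col G i\<close> cancel.\<close>

lemma sum_principal_minors_cramer:
  fixes F G :: "'a :: field_char_0 mat"
  assumes F: "F \<in> carrier_mat n r" and G: "G \<in> carrier_mat r n" and L: "L \<in> carrier_mat r r"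
    and inv: "(G * F) * L = 1\<^sub>m r" and h: "h \<in> carrier_vec r" and i: "i < n"
  shows "(\<Sum>I | I \<subseteq> {..<n} \<and> card I = r \<and> i \<in> I.
      det (submatrix (replace_col (F * G) (F *\<^sub>v h) i) I I))
    = det (G * F) * ((F *\<^sub>v (L *\<^sub>v h)) $ i)"
proof -
  have FG: "F * G \<in> carrier_mat n n" using F G by auto
  have L0: "L *\<^sub>v 0\<^sub>v r = 0\<^sub>v r" using L by auto
  have "F *\<^sub>v 0\<^sub>v r = 0\<^sub>v n" using F by auto
  then have zero: "replace_col (F * G) (0\<^sub>v n) i = F * replace_col G (0\<^sub>v r) i"
    using replace_col_mult[OF F G, of "0\<^sub>v r"] by simp
  have c: "col G i \<in> carrier_vec r" using G by auto
  have Lh: "L *\<^sub>v h \<in> carrier_vec r" and Lc: "L *\<^sub>v col G i \<in> carrier_vec r"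
    using L h c by auto
  have fi: "row F i \<in> carrier_vec r" using F by auto
  have "(\<Sum>I | I \<subseteq> {..<n} \<and> card I = r \<and> i \<in> I.
      det (submatrix (replace_col (F * G) (F *\<^sub>v h) i) I I))
    = det (replace_col G h i * F) - det (replace_col G (0\<^sub>v r) i * F)"
    unfolding sum_principal_minors_replace_col[OF FG i]
    unfolding zero replace_col_mult[OF F G h]
    using F G by (simp add: sum_principal_minors_mult)
  also have "\<dots> = det (G * F) * (row F i \<bullet> (L *\<^sub>v (h - col G i)) - row F i \<bullet> (L *\<^sub>v (0\<^sub>v r - col G i)))"
    using det_replace_col_mult[OF F G L inv h i] det_replace_col_mult[OF F G L inv zero_carrier_vec i]
    by (simp add: algebra_simps)
  also have "row F i \<bullet> (L *\<^sub>v (h - col G i)) - row F i \<bullet> (L *\<^sub>v (0\<^sub>v r - col G i)) = row F i \<bullet> (L *\<^sub>v h)"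
    unfolding mult_minus_distrib_mat_vec[OF L h c] mult_minus_distrib_mat_vec[OF L zero_carrier_vec c]
    unfolding L0 scalar_prod_minus_distrib[OF fi Lh Lc] scalar_prod_minus_distrib[OF fi zero_carrier_vec Lc]
    using fi by simp
  also have "\<dots> = (F *\<^sub>v (L *\<^sub>v h)) $ i"
    using F i by simp
  finally show ?thesis .
qed

section \<open>Full-rank factorization\<close>

text \<open>\<open>F\<close> consists of a maximal independent set of columns of \<open>A\<close>,
  and \<open>G\<close> holds the coordinates of all columns in that basis. \<open>H\<close> selects
  the basis columns, whose coordinates are unit vectors; it certifies that \<open>G\<close> has full
  row rank.\<close>

lemma (in vec_space) rank_factorization:
  assumes A: "A \<in> carrier_mat n nc"
  obtains F G H where "F \<in> carrier_mat n (rank A)" "G \<in> carrier_mat (rank A) nc"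
    "H \<in> carrier_mat nc (rank A)" "A = F * G" "G * H = 1\<^sub>m (rank A)"
    "\<And>v. v \<in> carrier_vec (rank A) \<Longrightarrow> F *\<^sub>v v = 0\<^sub>v n \<Longrightarrow> v = 0\<^sub>v (rank A)"
proof -
  define r where "r = rank A"
  have colsA: "set (cols A) \<subseteq> carrier_vec n"
    using A cols_dim by blast
  have "lin_indpt {}"
    by (metis empty_subsetI fin_dim finite_basis_exists subset_li_is_li vec_vs vectorspace.basis_def)
  then obtain S where max: "maximal S (\<lambda>T. T \<subseteq> set (cols A) \<and> lin_indpt T)"
    using maximal_exists_superset[of "set (cols A)" "\<lambda>T. T \<subseteq> set (cols A) \<and> lin_indpt T" "{}"]
    by auto
  then have S: "S \<subseteq> set (cols A)" and li: "lin_indpt S"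
    unfolding maximal_def by auto
  have finS: "finite S" using S finite_subset by blast
  have Sc: "S \<subseteq> carrier_vec n" using S colsA by blast
  have r: "r = card S"
    unfolding r_def by (rule rank_card_indpt[OF A max])
  have in_span: "c \<in> span S" if c: "c \<in> set (cols A)" for c
  proof (rule ccontr)
    assume nc: "c \<notin> span S"
    then have "c \<notin> S" using in_own_span[OF Sc] by auto
    \<comment> \<open>A column outside the span could be adjoined, against maximality.\<close>
    moreover have "lin_indpt (insert c S)"
      using lin_dep_iff_in_span[of S c] nc li Sc c colsA \<open>c \<notin> S\<close> by auto
    ultimately show False
      using max S c unfolding maximal_def by (metis insert_subset insertI1 subset_insertI)
  qed
  obtain xs where xs: "set xs = S" "distinct xs"
    using finite_distinct_list[OF finS] by blast
  have len: "length xs = r" using xs r distinct_card by fastforce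
  define F where "F = mat_of_cols n xs"
  have F: "F \<in> carrier_mat n r" unfolding F_def using len by auto
  have colsF: "cols F = xs" unfolding F_def using xs Sc by simp
  have inj: "v = 0\<^sub>v r" if "v \<in> carrier_vec r" "F *\<^sub>v v = 0\<^sub>v n" for v
    using lin_depI[OF F that(1) _ that(2)] li xs colsF by auto
  have "\<exists>g. g \<in> carrier_vec r \<and> F *\<^sub>v g = col A j" if "j < nc" for j
  proof -
    have "col A j \<in> set (cols A)"
      using that A by (metis carrier_matD(2) cols_length cols_nth nth_mem)
    then obtain a where "lincomb a S = col A j"
      using finite_in_span[OF finS _ in_span, of "col A j"] Sc by auto
    then show ?thesis
      using mat_mult_eq_lincomb[OF F, of a] xs colsF
      by (intro exI[of _ "vec r (\<lambda>i. a (col F i))"]) simp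
  qed
  then obtain g where g: "\<And>j. j < nc \<Longrightarrow> g j \<in> carrier_vec r"
    and Fg: "\<And>j. j < nc \<Longrightarrow> F *\<^sub>v g j = col A j"
    by metis
  define G where "G = mat r nc (\<lambda>(i, j). g j $ i)"
  have G: "G \<in> carrier_mat r nc" unfolding G_def by simp
  have colG: "col G j = g j" if "j < nc" for j
    using g[OF that] that unfolding G_def by (intro eq_vecI) simp_all
  have AFG: "A = F * G"
  proof (rule eq_matI)
    fix i j assume "i < dim_row (F * G)" "j < dim_col (F * G)"
    then have i: "i < n" and j: "j < nc" using F G by simp_all
    have "(F * G) $$ (i, j) = (F *\<^sub>v g j) $ i"
      using i j F G colG by simp
    then show "A $$ (i, j) = (F * G) $$ (i, j)"
      using Fg[OF j] i j A by simp
  qed (use A F G in auto)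
  have "\<exists>j. j < nc \<and> col A j = xs ! k" if "k < r" for k
  proof -
    have "xs ! k \<in> set (cols A)" using that len xs S by (metis nth_mem subsetD)
    then show ?thesis
      using A by (metis carrier_matD(2) cols_length cols_nth in_set_conv_nth)
  qed
  then obtain idx where idx: "\<And>k. k < r \<Longrightarrow> idx k < nc"
    and col_idx: "\<And>k. k < r \<Longrightarrow> col A (idx k) = xs ! k"
    by metis
  \<comment> \<open>\<open>F\<close> sends both vectors to the same basis column, so injectivity
    identifies them.\<close>
  have g_idx: "g (idx k) = unit_vec r k" if k: "k < r" for k
  proof -
    have gk: "g (idx k) \<in> carrier_vec r" using g idx k by blast
    have "F *\<^sub>v unit_vec r k = col F k"
      using F k by (intro eq_vecI) simp_all
    also have "\<dots> = xs ! k" using colsF F k by (metis carrier_matD(2) cols_nth)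
    finally have "F *\<^sub>v g (idx k) = F *\<^sub>v unit_vec r k"
      using Fg[OF idx[OF k]] col_idx[OF k] by simp
    then have "F *\<^sub>v (g (idx k) - unit_vec r k) = 0\<^sub>v n"
      using F gk by (simp add: mult_minus_distrib_mat_vec[OF F gk unit_vec_carrier])
    then have z: "g (idx k) - unit_vec r k = 0\<^sub>v r"
      using gk by (intro inj) simp_all
    show ?thesis
    proof (rule eq_vecI)
      fix l assume "l < dim_vec (unit_vec r k)"
      then show "g (idx k) $ l = unit_vec r k $ l"
        using arg_cong[OF z, of "\<lambda>v. v $ l"] gk by simp
    qed (use gk in simp)
  qed
  define H where "H = mat nc r (\<lambda>(j, k). if j = idx k then 1 else 0 :: 'a)"
  have H: "H \<in> carrier_mat nc r" unfolding H_def by simp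
  have "G * H = 1\<^sub>m r"
  proof (rule eq_matI)
    fix i k assume "i < dim_row (1\<^sub>m r)" "k < dim_col (1\<^sub>m r)"
    then have i: "i < r" and k: "k < r" by simp_all
    have "col H k = unit_vec nc (idx k)"
      using k unfolding H_def by (intro eq_vecI) (simp_all add: unit_vec_def)
    then have "(G * H) $$ (i, k) = G $$ (i, idx k)"
      using i k idx[OF k] G H by simp
    also have "\<dots> = 1\<^sub>m r $$ (i, k)"
      using i k idx[OF k] g_idx[OF k] unfolding G_def by simp
    finally show "(G * H) $$ (i, k) = 1\<^sub>m r $$ (i, k)" .
  qed (use G H in auto)
  with that[of F G H] F G H AFG inj show thesis
    unfolding r_def by blast
qed

section \<open>Adjoints, positive definiteness and uniqueness of the weighted inverse\<close>

text \<open>Stated with dimension equations instead of carriers, so that it can serve as a rewrite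
  rule.\<close>

lemma mult_mat_assoc:
  fixes A B C :: "'a :: semiring_0 mat"
  assumes "dim_col A = dim_row B" "dim_col B = dim_row C"
  shows "A * B * C = A * (B * C)"
  using assms by (intro assoc_mult_mat) auto

lemma mult_mat_vec_zero:
  fixes A :: "'a :: semiring_0 mat"
  assumes "A \<in> carrier_mat m n"
  shows "A *\<^sub>v 0\<^sub>v n = 0\<^sub>v m"
  using assms by (intro eq_vecI) simp_all

lemma dim_mat_adjoint [simp]:
  "dim_row (mat_adjoint A) = dim_col A" "dim_col (mat_adjoint A) = dim_row A"
  by (simp_all add: mat_adjoint_def)

lemma mat_adjoint_carrier: "A \<in> carrier_mat m n \<Longrightarrow> mat_adjoint A \<in> carrier_mat n m"
  by (intro carrier_matI) simp_all

lemma index_mat_adjoint: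
  "i < dim_col A \<Longrightarrow> j < dim_row A \<Longrightarrow> mat_adjoint A $$ (i, j) = conjugate (A $$ (j, i))"
  by (simp add: mat_adjoint_def mat_of_rows_index)

lemma mat_adjoint_mult:
  assumes "dim_col A = dim_row B"
  shows "mat_adjoint (A * B) = mat_adjoint B * mat_adjoint A"
proof (rule eq_matI)
  fix i j assume "i < dim_row (mat_adjoint B * mat_adjoint A)" "j < dim_col (mat_adjoint B * mat_adjoint A)"
  then have i: "i < dim_col B" and j: "j < dim_row A" by simp_all
  then show "mat_adjoint (A * B) $$ (i, j) = (mat_adjoint B * mat_adjoint A) $$ (i, j)"
    using assms
    by (simp add: index_mat_adjoint scalar_prod_def sum_conjugate conjugate_dist_mul mult.commute)
qed simp_all

lemma mat_adjoint_adjoint [simp]: "mat_adjoint (mat_adjoint A) = A"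
  by (rule eq_matI) (simp_all add: index_mat_adjoint)

lemma mat_adjoint_one [simp]: "mat_adjoint (1\<^sub>m n :: complex mat) = 1\<^sub>m n"
  by (rule eq_matI) (auto simp: index_mat_adjoint)

text \<open>Links the two-sided inverse to \<open>mat_inverse\<close>, through which
  \<open>sharp\<close> is defined.\<close>

lemma det_nonzero_obtain_inverse:
  fixes A :: "'a :: field mat"
  assumes A: "A \<in> carrier_mat n n" and "det A \<noteq> 0"
  obtains B where "B \<in> carrier_mat n n" "A * B = 1\<^sub>m n" "B * A = 1\<^sub>m n" "mat_inverse A = Some B"
proof (cases "mat_inverse A")
  case None
  then show ?thesis
    using mat_inverse(1)[OF A None, of "()"] det_non_zero_imp_unit[OF assms, of "()"] by blast
next
  case (Some B)
  then show ?thesis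
    using mat_inverse(2)[OF A Some] that by blast
qed

lemma mat_adjoint_inverse:
  fixes A B :: "complex mat"
  assumes A: "A \<in> carrier_mat n n" and B: "B \<in> carrier_mat n n"
    and inv: "A * B = 1\<^sub>m n" "B * A = 1\<^sub>m n" and herm: "mat_adjoint A = A"
  shows "mat_adjoint B = B"
proof -
  have "mat_adjoint B * A = 1\<^sub>m n"
    using mat_adjoint_mult[of A B] A B inv(1) herm by simp
  then have "mat_adjoint B * A * B = B"
    using B by simp
  moreover have "mat_adjoint B * A * B = mat_adjoint B"
    using A B inv(1) mat_adjoint_carrier[OF B] by (simp add: mult_mat_assoc)
  ultimately show ?thesis by simp
qed

text \<open>The adjoint relation for the standard inner product, in the coordinate form used by
  \<open>hermitian_posdef\<close>.\<close>

lemma sum_cnj_mult_mat_vec: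
  assumes F: "F \<in> carrier_mat k r" and v: "v \<in> carrier_vec r" and y: "y \<in> carrier_vec k"
  shows "(\<Sum>i<k. cnj ((F *\<^sub>v v) $ i) * y $ i) = (\<Sum>a<r. cnj (v $ a) * (mat_adjoint F *\<^sub>v y) $ a)"
proof -
  have 1: "(F *\<^sub>v v) $ i = (\<Sum>a<r. F $$ (i, a) * v $ a)" if "i < k" for i
    using that F v by (simp add: scalar_prod_def lessThan_atLeast0)
  have 2: "(mat_adjoint F *\<^sub>v y) $ a = (\<Sum>i<k. cnj (F $$ (i, a)) * y $ i)" if "a < r" for a
    using that F y mat_adjoint_carrier[OF F]
    by (simp add: scalar_prod_def lessThan_atLeast0 index_mat_adjoint)
  have "(\<Sum>i<k. cnj ((F *\<^sub>v v) $ i) * y $ i)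
      = (\<Sum>i<k. \<Sum>a<r. cnj (F $$ (i, a)) * cnj (v $ a) * y $ i)"
    by (intro sum.cong refl) (simp add: 1 sum_distrib_right)
  also have "\<dots> = (\<Sum>a<r. \<Sum>i<k. cnj (F $$ (i, a)) * cnj (v $ a) * y $ i)"
    by (rule sum.swap)
  also have "\<dots> = (\<Sum>a<r. cnj (v $ a) * (mat_adjoint F *\<^sub>v y) $ a)"
    by (intro sum.cong refl) (simp add: 2 sum_distrib_left algebra_simps)
  finally show ?thesis .
qed

text \<open>For a kernel vector \<open>v\<close> of the congruent matrix, the form of
  \<open>P\<close> vanishes at \<open>F *\<^sub>v v\<close>; definiteness and injectivity of
  \<open>F\<close> then force \<open>v\<close> to be zero.\<close>

lemma hermitian_posdef_congruence_det:
  assumes P: "hermitian_posdef k P" and F: "F \<in> carrier_mat k r"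
    and inj: "\<And>v. v \<in> carrier_vec r \<Longrightarrow> F *\<^sub>v v = 0\<^sub>v k \<Longrightarrow> v = 0\<^sub>v r"
  shows "det (mat_adjoint F * (P * F)) \<noteq> 0"
proof
  have Pc: "P \<in> carrier_mat k k" using P unfolding hermitian_posdef_def by blast
  note Fa = mat_adjoint_carrier[OF F]
  have carr: "mat_adjoint F * (P * F) \<in> carrier_mat r r" using Pc F Fa by auto
  assume "det (mat_adjoint F * (P * F)) = 0"
  then obtain v where v: "v \<in> carrier_vec r" "v \<noteq> 0\<^sub>v r" "(mat_adjoint F * (P * F)) *\<^sub>v v = 0\<^sub>v r"
    using det_0_iff_vec_prod_zero[OF carr] by blast
  define x where "x = F *\<^sub>v v"
  have x: "x \<in> carrier_vec k" unfolding x_def using F v by auto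
  have "mat_adjoint F *\<^sub>v (P *\<^sub>v x) = 0\<^sub>v r"
    using v assoc_mult_mat_vec[OF Fa mult_carrier_mat[OF Pc F] v(1)] assoc_mult_mat_vec[OF Pc F v(1)]
    unfolding x_def by simp
  then have "(\<Sum>i<k. cnj (x $ i) * (P *\<^sub>v x) $ i) = 0"
    using sum_cnj_mult_mat_vec[OF F v(1), of "P *\<^sub>v x"] Pc x v(1) unfolding x_def by simp
  moreover have "0 < Re (\<Sum>i<k. cnj (x $ i) * (P *\<^sub>v x) $ i)" if "x \<noteq> 0\<^sub>v k"
    using P x that unfolding hermitian_posdef_def by blast
  ultimately have "x = 0\<^sub>v k" by force
  then show False
    using inj[OF v(1)] v(2) unfolding x_def by blast
qed

lemma hermitian_posdef_det:
  assumes P: "hermitian_posdef k P"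
  shows "det P \<noteq> 0"
proof -
  have "P \<in> carrier_mat k k" using P unfolding hermitian_posdef_def by blast
  then show ?thesis
    using hermitian_posdef_congruence_det[OF P one_carrier_mat] by simp
qed

text \<open>Penrose's argument with weights: first \<open>A * X = A * Y\<close> and
  \<open>Y * A = X * A\<close> are obtained, then
  \<open>X = X * A * X = Y * A * X = Y * A * Y = Y\<close>.\<close>

lemma is_wmp_inverse_unique:
  assumes M: "hermitian_posdef m M" and N: "hermitian_posdef n N" and A: "A \<in> carrier_mat m n"
    and X: "is_wmp_inverse M N A X" and Y: "is_wmp_inverse M N A Y"
  shows "X = Y"
proof -
  have Mc: "M \<in> carrier_mat m m" and Mh: "mat_adjoint M = M"
    and Nc: "N \<in> carrier_mat n n" and Nh: "mat_adjoint N = N"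
    using M N unfolding hermitian_posdef_def by auto
  have cancel: "S = T" if P: "P \<in> carrier_mat k k" "det P \<noteq> 0"
    and ST: "S \<in> carrier_mat k l" "T \<in> carrier_mat k l" "P * S = P * T" for P S T :: "complex mat" and k l
  proof -
    obtain Q where Q: "Q \<in> carrier_mat k k" "Q * P = 1\<^sub>m k"
      using det_nonzero_obtain_inverse[OF P] by metis
    have "Q * P * S = Q * P * T"
      using P ST Q(1) by (simp add: mult_mat_assoc)
    then show ?thesis
      using ST Q(2) by simp
  qed
  have Xc: "X \<in> carrier_mat n m" and Yc: "Y \<in> carrier_mat n m"
    using X Y A unfolding is_wmp_inverse_def by auto
  have AXA: "A * (X * A) = A" and XAX: "X * (A * X) = X"
    and hX: "mat_adjoint (M * (A * X)) = M * (A * X)" and hX': "mat_adjoint (N * (X * A)) = N * (X * A)"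
    using X Mc Nc A Xc unfolding is_wmp_inverse_def by (simp_all add: mult_mat_assoc)
  have AYA: "A * (Y * A) = A" and YAY: "Y * (A * Y) = Y"
    and hY: "mat_adjoint (M * (A * Y)) = M * (A * Y)" and hY': "mat_adjoint (N * (Y * A)) = N * (Y * A)"
    using Y Mc Nc A Yc unfolding is_wmp_inverse_def by (simp_all add: mult_mat_assoc)
  \<comment> \<open>As the weights are Hermitian, the last two defining equations say that
    \<open>A * X\<close> and \<open>X * A\<close> are self-adjoint for the inner products given by
    \<open>M\<close> and \<open>N\<close>.\<close>
  have aX: "mat_adjoint (A * X) * M = M * (A * X)" and aY: "mat_adjoint (A * Y) * M = M * (A * Y)"
    using hX hY Mc Mh A Xc Yc by (simp_all add: mat_adjoint_mult[of M])
  have aX': "mat_adjoint (X * A) * N = N * (X * A)" and aY': "mat_adjoint (Y * A) * N = N * (Y * A)"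
    using hX' hY' Nc Nh A Xc Yc by (simp_all add: mat_adjoint_mult[of N])
  have "M * (A * X) = M * ((A * Y) * (A * X))"
  proof -
    have "(A * Y) * (A * X) = (A * (Y * A)) * X" using A Xc Yc by (simp add: mult_mat_assoc)
    then show ?thesis by (simp add: AYA)
  qed
  also have "\<dots> = (mat_adjoint (A * Y) * M) * (A * X)"
    unfolding aY using A Xc Yc Mc by (simp add: mult_mat_assoc)
  also have "\<dots> = mat_adjoint (A * Y) * (mat_adjoint (A * X) * M)"
    unfolding aX using A Xc Yc Mc by (simp add: mult_mat_assoc)
  also have "\<dots> = mat_adjoint ((A * X) * (A * Y)) * M"
    using A Xc Yc Mc mat_adjoint_mult[of "A * X" "A * Y"]
      mult_mat_assoc[of "mat_adjoint (A * Y)" "mat_adjoint (A * X)" M] by simp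
  also have "(A * X) * (A * Y) = (A * (X * A)) * Y" using A Xc Yc by (simp add: mult_mat_assoc)
  finally have "M * (A * X) = M * (A * Y)" unfolding AXA aY .
  then have 1: "A * X = A * Y"
    by (rule cancel[OF Mc hermitian_posdef_det[OF M] mult_carrier_mat[OF A Xc] mult_carrier_mat[OF A Yc]])
  have "N * (Y * A) = N * ((Y * A) * (X * A))"
  proof -
    have "(Y * A) * (X * A) = Y * (A * (X * A))" using A Xc Yc by (simp add: mult_mat_assoc)
    then show ?thesis by (simp add: AXA)
  qed
  also have "\<dots> = (mat_adjoint (Y * A) * N) * (X * A)"
    unfolding aY' using A Xc Yc Nc by (simp add: mult_mat_assoc)
  also have "\<dots> = mat_adjoint (Y * A) * (mat_adjoint (X * A) * N)"
    unfolding aX' using A Xc Yc Nc by (simp add: mult_mat_assoc)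
  also have "\<dots> = mat_adjoint ((X * A) * (Y * A)) * N"
    using A Xc Yc Nc mat_adjoint_mult[of "X * A" "Y * A"]
      mult_mat_assoc[of "mat_adjoint (Y * A)" "mat_adjoint (X * A)" N] by simp
  also have "(X * A) * (Y * A) = X * (A * (Y * A))" using A Xc Yc by (simp add: mult_mat_assoc)
  finally have "N * (Y * A) = N * (X * A)" unfolding AYA aX' .
  then have 2: "Y * A = X * A"
    by (rule cancel[OF Nc hermitian_posdef_det[OF N] mult_carrier_mat[OF Yc A] mult_carrier_mat[OF Xc A]])
  have "X = (X * A) * X" using XAX A Xc by (simp add: mult_mat_assoc)
  also have "\<dots> = Y * (A * X)" unfolding 2[symmetric] using A Xc Yc by (simp add: mult_mat_assoc)
  also have "\<dots> = Y" unfolding 1 by (rule YAY)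
  finally show ?thesis .
qed

section \<open>The determinantal representation\<close>

text \<open>The weighted analogue of the full-rank formula for the Moore--Penrose inverse:
  \<open>K\<close> is the inverse of \<open>N\<close>, while \<open>P\<close> and \<open>Q\<close>
  invert the weighted Gram matrices of \<open>G\<close> and \<open>F\<close>.\<close>

lemma is_wmp_inverse_factorization:
  assumes M: "hermitian_posdef m M" and N: "hermitian_posdef n N"
    and F: "F \<in> carrier_mat m r" and G: "G \<in> carrier_mat r n"
    and K: "K \<in> carrier_mat n n" "N * K = 1\<^sub>m n" "K * N = 1\<^sub>m n"
    and P: "P \<in> carrier_mat r r" "P * (G * (K * mat_adjoint G)) = 1\<^sub>m r"
      "(G * (K * mat_adjoint G)) * P = 1\<^sub>m r"
    and Q: "Q \<in> carrier_mat r r" "Q * (mat_adjoint F * (M * F)) = 1\<^sub>m r"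
      "(mat_adjoint F * (M * F)) * Q = 1\<^sub>m r"
  shows "is_wmp_inverse M N (F * G) (K * (mat_adjoint G * (P * (Q * (mat_adjoint F * M)))))"
proof -
  define Fs Gs where "Fs = mat_adjoint F" and "Gs = mat_adjoint G"
  have Mc: "M \<in> carrier_mat m m" and Mh: "mat_adjoint M = M"
    and Nc: "N \<in> carrier_mat n n" and Nh: "mat_adjoint N = N"
    using M N unfolding hermitian_posdef_def by auto
  have Fs: "Fs \<in> carrier_mat r m" and Gs: "Gs \<in> carrier_mat n r"
    unfolding Fs_def Gs_def using F G by (auto intro: mat_adjoint_carrier)
  have adj: "mat_adjoint F = Fs" "mat_adjoint Fs = F" "mat_adjoint G = Gs" "mat_adjoint Gs = G"
    unfolding Fs_def Gs_def by simp_all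
  note carriers = Mc Nc F G Fs Gs K(1) P(1) Q(1)
  note dims = carriers[THEN carrier_matD(1)] carriers[THEN carrier_matD(2)]
  have Kh: "mat_adjoint K = K"
    by (rule mat_adjoint_inverse[OF Nc K Nh])
  have Ph: "mat_adjoint P = P"
    by (rule mat_adjoint_inverse[OF _ P(1) P(3) P(2)])
      (use dims in \<open>auto simp: adj mat_adjoint_mult mult_mat_assoc Kh\<close>)
  have Qh: "mat_adjoint Q = Q"
    by (rule mat_adjoint_inverse[OF _ Q(1) Q(3) Q(2)])
      (use dims in \<open>auto simp: adj mat_adjoint_mult mult_mat_assoc Mh\<close>)
  \<comment> \<open>The trailing factor \<open>Z\<close> lets each cancellation act inside
    right-associated products, which is how all four defining equations are simplified.\<close>
  have cN: "N * (K * Z) = Z" if "dim_row Z = n" for Z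
    using that K(2) dims left_mult_one_mat[of Z n "dim_col Z"] by (simp flip: mult_mat_assoc)
  have cP: "P * (G * (K * (Gs * Z))) = Z" if "dim_row Z = r" for Z
  proof -
    have "P * (G * (K * (Gs * Z))) = (P * (G * (K * Gs))) * Z"
      using that dims by (simp add: mult_mat_assoc)
    then show ?thesis
      using that P(2) left_mult_one_mat[of Z r "dim_col Z"] by (simp add: adj)
  qed
  have cP': "G * (K * (Gs * (P * Z))) = Z" if "dim_row Z = r" for Z
  proof -
    have "G * (K * (Gs * (P * Z))) = ((G * (K * Gs)) * P) * Z"
      using that dims by (simp add: mult_mat_assoc)
    then show ?thesis
      using that P(3) left_mult_one_mat[of Z r "dim_col Z"] by (simp add: adj)
  qed
  have cQ: "Q * (Fs * (M * (F * Z))) = Z" if "dim_row Z = r" for Z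
  proof -
    have "Q * (Fs * (M * (F * Z))) = (Q * (Fs * (M * F))) * Z"
      using that dims by (simp add: mult_mat_assoc)
    then show ?thesis
      using that Q(2) left_mult_one_mat[of Z r "dim_col Z"] by (simp add: adj)
  qed
  show ?thesis
    unfolding is_wmp_inverse_def
    using dims
    by (auto simp: adj mat_adjoint_mult mult_mat_assoc Kh Ph Qh Mh Nh cN cP cP' cQ)
qed

theorem theorem2p4:
  fixes M N A :: "complex mat" and m n r :: nat
  assumes "hermitian_posdef m M" and "hermitian_posdef n N"
    and "A \<in> carrier_mat m n"
    and "vec_space.rank m A = r" and "r < min m n"
  shows "\<forall>i < n. \<forall>j < m.
    wmp_inverse M N A $$ (i, j) =
      (\<Sum>\<beta> \<in> {\<beta>. \<beta> \<subseteq> {..<n} \<and> card \<beta> = r \<and> i \<in> \<beta>}.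
         det (submatrix (replace_col (sharp M N A * A) (col (sharp M N A) j) i) \<beta> \<beta>))
    / (\<Sum>\<beta> \<in> {\<beta>. \<beta> \<subseteq> {..<n} \<and> card \<beta> = r}.
         det (submatrix (sharp M N A * A) \<beta> \<beta>))"
proof (intro allI impI)
  fix i j assume i: "i < n" and j: "j < m"
  note M = assms(1) and N = assms(2) and A = assms(3)
  obtain F G H where F: "F \<in> carrier_mat m r" and G: "G \<in> carrier_mat r n"
    and H: "H \<in> carrier_mat n r" and AFG: "A = F * G" and GH: "G * H = 1\<^sub>m r"
    and inj: "\<And>v. v \<in> carrier_vec r \<Longrightarrow> F *\<^sub>v v = 0\<^sub>v m \<Longrightarrow> v = 0\<^sub>v r"
    using vec_space.rank_factorization[OF A] assms(4) by metis
  define Fs Gs where "Fs = mat_adjoint F" and "Gs = mat_adjoint G"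
  have Mc: "M \<in> carrier_mat m m" and Nc: "N \<in> carrier_mat n n" and Nh: "mat_adjoint N = N"
    using M N unfolding hermitian_posdef_def by auto
  have Fs: "Fs \<in> carrier_mat r m" and Gs: "Gs \<in> carrier_mat n r"
    unfolding Fs_def Gs_def using F G by (auto intro: mat_adjoint_carrier)
  obtain K where K: "K \<in> carrier_mat n n" "N * K = 1\<^sub>m n" "K * N = 1\<^sub>m n"
    and invN: "mat_inverse N = Some K"
    using det_nonzero_obtain_inverse[OF Nc hermitian_posdef_det[OF N]] by metis
  have Kh: "mat_adjoint K = K"
    by (rule mat_adjoint_inverse[OF Nc K Nh])
  \<comment> \<open>Now \<open>Q\<close> and \<open>P\<close> are the Gram matrices themselves;
    their inverses \<open>Qi\<close> and \<open>Pi\<close> are what the factorization formula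
    takes.\<close>
  define Q where "Q = Fs * (M * F)"
  define P where "P = G * (K * Gs)"
  have Qc: "Q \<in> carrier_mat r r" and Pc: "P \<in> carrier_mat r r"
    unfolding Q_def P_def using Fs Gs F G Mc K(1) by auto
  have detQ: "det Q \<noteq> 0"
    unfolding Q_def Fs_def by (rule hermitian_posdef_congruence_det[OF M F inj])
  \<comment> \<open>\<open>mat_adjoint H * N\<close> is a left inverse of \<open>K * Gs\<close>,
    because \<open>G * H\<close> is the identity.\<close>
  have injG: "v = 0\<^sub>v r" if v: "v \<in> carrier_vec r" and KGv: "(K * Gs) *\<^sub>v v = 0\<^sub>v n" for v
  proof -
    have "(mat_adjoint H * N) * (K * Gs) = mat_adjoint H * ((N * K) * Gs)"
      using H Nc K(1) Gs by (simp add: mult_mat_assoc)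
    also have "\<dots> = mat_adjoint (G * H)"
      using G H Gs by (simp add: K(2) mat_adjoint_mult Gs_def)
    also have "\<dots> = 1\<^sub>m r" by (simp add: GH)
    finally have "v = (mat_adjoint H * N) *\<^sub>v ((K * Gs) *\<^sub>v v)"
      using assoc_mult_mat_vec[OF mult_carrier_mat[OF mat_adjoint_carrier[OF H] Nc]
          mult_carrier_mat[OF K(1) Gs] v] v by simp
    also have "\<dots> = 0\<^sub>v r"
      unfolding KGv by (rule mult_mat_vec_zero[OF mult_carrier_mat[OF mat_adjoint_carrier[OF H] Nc]])
    finally show ?thesis .
  qed
  \<comment> \<open>Written as a congruence of \<open>N\<close>, \<open>P\<close> is nonsingular by
    the definiteness of \<open>N\<close> itself.\<close>
  have "P = mat_adjoint (K * Gs) * (N * (K * Gs))"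
  proof -
    have "mat_adjoint (K * Gs) * (N * (K * Gs)) = (G * K) * ((N * K) * Gs)"
      using K(1) G Gs Nc Gs_def by (simp add: mat_adjoint_mult Kh mult_mat_assoc)
    then show ?thesis
      unfolding K(2) P_def using G K(1) Gs by (simp add: mult_mat_assoc)
  qed
  then have detP: "det P \<noteq> 0"
    using hermitian_posdef_congruence_det[OF N mult_carrier_mat[OF K(1) Gs] injG] by simp
  obtain Qi where Qi: "Qi \<in> carrier_mat r r" "Q * Qi = 1\<^sub>m r" "Qi * Q = 1\<^sub>m r"
    using det_nonzero_obtain_inverse[OF Qc detQ] by metis
  obtain Pi where Pi: "Pi \<in> carrier_mat r r" "P * Pi = 1\<^sub>m r" "Pi * P = 1\<^sub>m r"
    using det_nonzero_obtain_inverse[OF Pc detP] by metis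
  define X where "X = K * (Gs * (Pi * (Qi * (Fs * M))))"
  have "is_wmp_inverse M N A X"
    unfolding AFG X_def Fs_def Gs_def
    by (rule is_wmp_inverse_factorization[OF M N F G K Pi(1) _ _ Qi(1)])
      (use Pi Qi in \<open>simp_all add: P_def Q_def Fs_def Gs_def\<close>)
  then have wmp: "wmp_inverse M N A = X"
    unfolding wmp_inverse_def using is_wmp_inverse_unique[OF M N A] by blast
  \<comment> \<open>\<open>T\<close> equals \<open>sharp M N A * F\<close>, and \<open>Y\<close> is
    the left inverse of \<open>F\<close> weighted by \<open>M\<close>. Both
    \<open>sharp M N A\<close> and its product with \<open>A\<close> then have \<open>T\<close> as
    left factor.\<close>
  define T where "T = K * (Gs * Q)"
  define Y where "Y = Qi * (Fs * M)"
  have Y: "Y \<in> carrier_mat r m" unfolding Y_def using Qi(1) Fs Mc by auto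
  define h where "h = col Y j"
  have T: "T \<in> carrier_mat n r" unfolding T_def using K(1) Gs Qc by auto
  have h: "h \<in> carrier_vec r" unfolding h_def by (rule col_carrier_vec[OF j Y])
  note carriers = Mc Nc F G Fs Gs K(1) Pi(1) Qi(1) Pc Qc T
  note dims = carriers[THEN carrier_matD(1)] carriers[THEN carrier_matD(2)]
  have sharp: "sharp M N A = K * (Gs * (Fs * M))"
    unfolding sharp_def invN AFG using dims
    by (simp add: mat_adjoint_mult mult_mat_assoc Fs_def Gs_def)
  have cQ: "Q * (Qi * Z) = Z" if "dim_row Z = r" for Z
    using that Qi(2) dims left_mult_one_mat[of Z r "dim_col Z"] by (simp flip: mult_mat_assoc)
  have sharpA: "sharp M N A * A = T * G"
    unfolding sharp unfolding AFG T_def Q_def using dims by (simp add: mult_mat_assoc)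
  have "sharp M N A = T * Y"
    unfolding sharp T_def Y_def using dims by (simp add: mult_mat_assoc cQ)
  then have col_sharp: "col (sharp M N A) j = T *\<^sub>v h"
    unfolding h_def using col_mult2[OF T Y j] by simp
  have GT: "G * T = P * Q"
    unfolding T_def P_def using dims by (simp add: mult_mat_assoc)
  have inv: "(G * T) * (Qi * Pi) = 1\<^sub>m r"
    unfolding GT using dims Pi(2) by (simp add: mult_mat_assoc cQ)
  have L: "Qi * Pi \<in> carrier_mat r r" using Qi(1) Pi(1) by auto
  \<comment> \<open>With \<open>Qi * Pi\<close> inverse to \<open>G * T\<close>, column
    \<open>j\<close> of \<open>X\<close> becomes exactly the vector produced by the Cramer-type
    formula for \<open>h\<close>.\<close>
  have X_eq: "X = T * ((Qi * Pi) * Y)"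
    unfolding X_def T_def Y_def using dims by (simp add: mult_mat_assoc cQ)
  have "X $$ (i, j) = col X j $ i"
    using i j T Y by (simp add: X_eq)
  also have "col X j = T *\<^sub>v ((Qi * Pi) *\<^sub>v h)"
    unfolding X_eq col_mult2[OF T mult_carrier_mat[OF L Y] j] col_mult2[OF L Y j] h_def ..
  finally have "X $$ (i, j) = (T *\<^sub>v ((Qi * Pi) *\<^sub>v h)) $ i" .
  \<comment> \<open>This determinant is the denominator and also the factor of the numerator that
    cancels.\<close>
  moreover have "det (G * T) \<noteq> 0"
    unfolding GT using detP detQ det_mult[OF Pc Qc] by simp
  ultimately show "wmp_inverse M N A $$ (i, j) =
      (\<Sum>\<beta> \<in> {\<beta>. \<beta> \<subseteq> {..<n} \<and> card \<beta> = r \<and> i \<in> \<beta>}.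
         det (submatrix (replace_col (sharp M N A * A) (col (sharp M N A) j) i) \<beta> \<beta>))
    / (\<Sum>\<beta> \<in> {\<beta>. \<beta> \<subseteq> {..<n} \<and> card \<beta> = r}.
         det (submatrix (sharp M N A * A) \<beta> \<beta>))"
    unfolding wmp sharpA col_sharp sum_principal_minors_mult[OF T G]
      sum_principal_minors_cramer[OF T G L inv h i]
    by simp
qed

end
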